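(* Let $\mathcal D$ be the data of a Det-POMDP whose sets $\mathbb T,\mathbb X,\mathbb U,\mathbb O$ are finite, and assume that $|\mathbb U|>1$. Then, for every initial belief $b_0\in\Delta(\mathbb X)$, the set $\mathcal R^{\mathcal D}_{[1,T]}(b_0)$ of reachable beliefs starting from $b_0$ satisfies $$\bigl|\mathcal R^{\mathcal D}_{[1,T]}(b_0)\bigr|\;\le\;\min\Bigl((1+|\mathbb X|)^{|\mathrm{supp}(b_0)|},\;1+|\mathrm{supp}(b_0)|\,|\mathbb U|^{|\mathbb T|}\Bigr).$$
   Context: **Det-POMDP data.** A Det-POMDP is given by $\mathcal D=(\mathbb T,\mathbb U,\mathbb O,\mathbb X,(\mathcal L_t)_{t\in\mathbb T},(\varphi_t)_{t\in\mathbb T\setminus\{T\}},(\mathbb U^{\mathrm{ad}}_t)_{t\in\mathbb T\setminus\{T\}},(\beta_t)_{t\in\mathbb T})$, where $\mathbb T=\{0,1,\dots,T\}$ is the set of stages with horizon an integer $T\ge 1$; $\mathbb U,\mathbb O,\mathbb X$ are the sets of controls, observations and states; $\mathcal L_t:\mathbb X\times\mathbb U\to\mathbb R\cup\{+\infty\}$ ($t<T$) and $\mathcal L_T:\mathbb X\to\mathbb R\cup\{+\infty\}$ are costs; $\varphi_t:\mathbb X\times\mathbb U\to\mathbb X$ are the dynamics; $\mathbb U^{\mathrm{ad}}_t:\mathbb X\rightrightarrows\mathbb U$ are set-valued admissibility constraints; $\beta_0:\mathbb X\to\mathbb O$ and $\beta_t:\mathbb X\times\mathbb U\to\mathbb O$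 ($t\ge1$) are observation mappings. Write $\varphi_t^u=\varphi_t(\cdot,u)$ and $\beta_t^u=\beta_t(\cdot,u)$. **Beliefs.** $\Delta(\mathbb Y)$ is the set of probability distributions on a finite set $\mathbb Y$; $\mathrm{supp}(\mu)=\{y:\mu(\{y\})>0\}$; $|\cdot|$ is cardinality. Let $\partial\notin\mathbb X$, $\overline{\mathbb X}=\mathbb X\cup\{\partial\}$, let $\delta_\partial$ be the Dirac measure at $\partial$, and let $\mathbb B=\Delta(\mathbb X)\cup\{\delta_\partial\}\subset\Delta(\overline{\mathbb X})$, where $\Delta(\mathbb X)$ is identified with the probabilities on $\overline{\mathbb X}$ supported in $\mathbb X$. **Belief dynamics.** For $t\in\mathbb T\setminus\{T\}$ and $(b,u,o)\in\mathbb B\times\mathbb U\times\mathbb O$, let $Q_{t+1}(b,u,o)=b\bigl((\beta^u_{t+1}\circ\varphi^u_t)^{-1}(o)\bigr)$. Define $\theta_t:\mathbb B\times\mathbb U\times\mathbb O\to\mathbb B$ by: for $y\in\mathbb X$, $\theta_t(b,u,o)(y)=b\bigl((\varphi_t^u)^{-1}(y)\bigr)/Q_{t+1}(b,u,o)$ if $Q_{t+1}(b,u,o)\ne0$ and $y\in(\beta_{t+1}^u)^{-1}(o)$, and $\theta_t(b,u,o)(y)=0$ otherwise; and $\theta_t(b,u,o)(\partial)=1-\theta_t(b,u,o)(\mathbb X)$. **Reachable beliefs.** $\mathcal R^{\mathcal D}_0(b_0)=\{b_0\}$, $\mathcal R^{\mathcal D}_{t+1}(b_0)=\theta_t(\mathcal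 R^{\mathcal D}_t(b_0),\mathbb U,\mathbb O)=\{\theta_t(b,u,o): b\in\mathcal R^{\mathcal D}_t(b_0),u\in\mathbb U,o\in\mathbb O\}$ for $t<T$, and $\mathcal R^{\mathcal D}_{[1,T]}(b_0)=\bigcup_{t=1}^T\mathcal R^{\mathcal D}_t(b_0)$. *)

theory Defs
  imports "HOL-Probability.Probability"
begin

text \<open>
  The sets of states, controls and observations are the types \<open>'x\<close>, \<open>'u\<close>, \<open>'o\<close>.
  The stages are \<open>0, \<dots>, horizon\<close>. Families indexed by stages are functions on \<^typ>\<open>nat\<close>
  whose values outside the relevant stages are never used: \<open>stage_cost\<close>, \<open>dyn\<close>, \<open>adm\<close> matter for
  \<open>t < horizon\<close>, and \<open>obs\<close> for \<open>1 \<le> t \<le> horizon\<close> (the stage-0 observation is \<open>obs0\<close>).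
\<close>

record ('x, 'u, 'o) det_pomdp =
  horizon :: nat
  stage_cost :: "nat \<Rightarrow> 'x \<Rightarrow> 'u \<Rightarrow> ereal"
  final_cost :: "'x \<Rightarrow> ereal"
  dyn :: "nat \<Rightarrow> 'x \<Rightarrow> 'u \<Rightarrow> 'x"
  adm :: "nat \<Rightarrow> 'x \<Rightarrow> 'u set"
  obs0 :: "'x \<Rightarrow> 'o"
  obs :: "nat \<Rightarrow> 'x \<Rightarrow> 'u \<Rightarrow> 'o"

definition valid_det_pomdp :: "('x, 'u, 'o) det_pomdp \<Rightarrow> bool" where
  "valid_det_pomdp D \<longleftrightarrow>
     1 \<le> horizon D \<and>
     (\<forall>t < horizon D. \<forall>x u. stage_cost D t x u \<noteq> -\<infinity>) \<and>
     (\<forall>x. final_cost D x \<noteq> -\<infinity>)"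

definition stages :: "('x, 'u, 'o) det_pomdp \<Rightarrow> nat set" where
  "stages D = {0..horizon D}"

text \<open>
  The extended state space is \<^typ>\<open>'x option\<close>, with \<^term>\<open>None\<close> as the added point. A distribution
  on states is identified with one on \<^typ>\<open>'x option\<close> that gives no mass to \<^term>\<open>None\<close>.
\<close>

definition state_beliefs :: "'x option pmf set" where
  "state_beliefs = {b. set_pmf b \<subseteq> range Some}"

definition beliefs :: "'x option pmf set" where
  "beliefs = state_beliefs \<union> {return_pmf None}"

definition obs_prob ::
    "('x, 'u, 'o) det_pomdp \<Rightarrow> nat \<Rightarrow> 'x option pmf \<Rightarrow> 'u \<Rightarrow> 'o \<Rightarrow> real" where
  "obs_prob D t b u z =
     measure_pmf.prob b (Some ` ((\<lambda>x. obs D (Suc t) (dyn D t x u) u) -` {z}))"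

definition theta_mass ::
    "('x, 'u, 'o) det_pomdp \<Rightarrow> nat \<Rightarrow> 'x option pmf \<Rightarrow> 'u \<Rightarrow> 'o \<Rightarrow> 'x \<Rightarrow> real" where
  "theta_mass D t b u z y =
     (if obs_prob D t b u z \<noteq> 0 \<and> y \<in> (\<lambda>x. obs D (Suc t) x u) -` {z}
      then measure_pmf.prob b (Some ` ((\<lambda>x. dyn D t x u) -` {y})) / obs_prob D t b u z
      else 0)"

definition theta ::
    "('x::finite, 'u, 'o) det_pomdp \<Rightarrow> nat \<Rightarrow> 'x option pmf \<Rightarrow> 'u \<Rightarrow> 'o \<Rightarrow> 'x option pmf" where
  "theta D t b u z =
     embed_pmf (\<lambda>y. case y of
         Some x \<Rightarrow> theta_mass D t b u z x
       | None \<Rightarrow> 1 - (\<Sum>x\<in>UNIV. theta_mass D t b u z x))"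

primrec reachable_at ::
    "('x::finite, 'u, 'o) det_pomdp \<Rightarrow> 'x option pmf \<Rightarrow> nat \<Rightarrow> 'x option pmf set" where
  "reachable_at D b0 0 = {b0}"
| "reachable_at D b0 (Suc t) = {theta D t b u z | b u z. b \<in> reachable_at D b0 t}"

definition reachable ::
    "('x::finite, 'u, 'o) det_pomdp \<Rightarrow> 'x option pmf \<Rightarrow> 'x option pmf set" where
  "reachable D b0 = (\<Union>t\<in>{1..horizon D}. reachable_at D b0 t)"

text \<open>
  The next lemmas show that the argument of \<^const>\<open>embed_pmf\<close> in \<^const>\<open>theta\<close> is a
  probability mass function, so that \<^const>\<open>theta\<close> has exactly the intended point masses,
  and that \<^const>\<open>theta\<close> maps beliefs to beliefs.
\<close>

lemma theta_mass_nonneg: "0 \<le> theta_mass D t b u z y"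
  by (simp add: theta_mass_def obs_prob_def)

lemma sum_theta_mass:
  fixes D :: "('x::finite, 'u, 'o) det_pomdp"
  shows "(\<Sum>y\<in>UNIV. theta_mass D t b u z y) = (if obs_prob D t b u z = 0 then 0 else 1)"
proof (cases "obs_prob D t b u z = 0")
  case True
  then show ?thesis by (simp add: theta_mass_def)
next
  case False
  let ?Y = "(\<lambda>x. obs D (Suc t) x u) -` {z}"
  let ?P = "\<lambda>y. Some ` ((\<lambda>x. dyn D t x u) -` {y})"
  have "(\<Sum>y\<in>?Y. measure_pmf.prob b (?P y)) = measure_pmf.prob b (\<Union>y\<in>?Y. ?P y)"
    by (rule measure_pmf.finite_measure_finite_Union [symmetric])
       (auto simp: disjoint_family_on_def)
  also have "(\<Union>y\<in>?Y. ?P y) = Some ` ((\<lambda>x. obs D (Suc t) (dyn D t x u) u) -` {z})"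
    by auto
  finally have *: "(\<Sum>y\<in>?Y. measure_pmf.prob b (?P y)) = obs_prob D t b u z"
    by (simp add: obs_prob_def)
  have "(\<Sum>y\<in>UNIV. theta_mass D t b u z y) = (\<Sum>y\<in>?Y. theta_mass D t b u z y)"
    by (rule sum.mono_neutral_right) (auto simp: theta_mass_def)
  also have "\<dots> = (\<Sum>y\<in>?Y. measure_pmf.prob b (?P y) / obs_prob D t b u z)"
    using False by (intro sum.cong) (auto simp: theta_mass_def)
  also have "\<dots> = 1"
    using False * by (simp flip: sum_divide_distrib)
  finally show ?thesis using False by simp
qed

lemma pmf_theta:
  fixes D :: "('x::finite, 'u, 'o) det_pomdp"
  shows "pmf (theta D t b u z) y =
    (case y of
       Some x \<Rightarrow> theta_mass D t b u z x
     | None \<Rightarrow> 1 - (\<Sum>x\<in>UNIV. theta_mass D t b u z x))"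
proof -
  let ?f = "\<lambda>y. case y of
       Some x \<Rightarrow> theta_mass D t b u z x
     | None \<Rightarrow> 1 - (\<Sum>x\<in>UNIV. theta_mass D t b u z x)"
  have nn: "0 \<le> ?f y" for y
    by (simp add: theta_mass_nonneg sum_theta_mass split: option.split)
  have "(\<Sum>y\<in>UNIV. ?f y) = 1"
    by (simp add: UNIV_option_conv sum.reindex)
  then have "(\<integral>\<^sup>+ y. ennreal (?f y) \<partial>count_space UNIV) = 1"
    using nn by (simp add: nn_integral_count_space_finite sum_ennreal)
  from pmf_embed_pmf [OF nn this] show ?thesis
    unfolding theta_def .
qed

lemma theta_in_beliefs:
  fixes D :: "('x::finite, 'u, 'o) det_pomdp"
  shows "theta D t b u z \<in> beliefs"
proof (cases "obs_prob D t b u z = 0")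
  case True
  have "theta D t b u z = return_pmf None"
    by (rule pmf_eqI) (auto simp: pmf_theta True theta_mass_def split: option.split)
  then show ?thesis by (simp add: beliefs_def)
next
  case False
  then have "pmf (theta D t b u z) None = 0"
    by (simp add: pmf_theta sum_theta_mass)
  then have "None \<notin> set_pmf (theta D t b u z)"
    by (simp add: set_pmf_iff)
  then have "set_pmf (theta D t b u z) \<subseteq> range Some"
    by (metis not_None_eq rangeI subsetI)
  then show ?thesis by (simp add: beliefs_def state_beliefs_def)
qed

end

theory Submission
  imports Defs
begin

text \<open>
  A step of the belief filter kills the states that contradict the observation, moves the others,
  and renormalises. Such conditioned push-forwards compose, so every reachable belief
  is the conditioned push-forward of the initial belief along a partial map on its support.
  There are at most \<open>(1 + |X|) ^ |supp b0|\<close> such maps. Moreover the controls and one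
  surviving initial state determine all observations, hence the belief; this gives the other bound.
\<close>

text \<open>The value \<open>None\<close> of \<open>g\<close> marks discarded points. If
  \<open>p\<close> gives no mass to the survivors there is nothing to condition on, and the value is
  set to \<open>return_pmf None\<close>, the belief at the added point.\<close>

definition cond_push :: "'a pmf \<Rightarrow> ('a \<Rightarrow> 'b option) \<Rightarrow> 'b option pmf" where
  "cond_push p g =
     (if set_pmf p \<inter> {y. g y \<noteq> None} = {} then return_pmf None
      else map_pmf g (cond_pmf p {y. g y \<noteq> None}))"

lemma measure_cond_pmf:
  assumes "set_pmf p \<inter> A \<noteq> {}"
  shows "measure_pmf.prob (cond_pmf p A) B = measure_pmf.prob p (A \<inter> B) / measure_pmf.prob p A"
proof -
  have "emeasure (measure_pmf p) A \<noteq> 0"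
    using assms by (simp add: measure_pmf.emeasure_eq_measure measure_pmf_zero_iff)
  then show ?thesis
    using assms by (simp add: cond_pmf.rep_eq measure_uniform_measure measure_pmf.emeasure_eq_measure)
qed

lemma pmf_cond_push:
  "pmf (cond_push p g) y =
    (if set_pmf p \<inter> {y. g y \<noteq> None} = {} then indicator {None} y
     else measure_pmf.prob p ({y. g y \<noteq> None} \<inter> g -` {y}) / measure_pmf.prob p {y. g y \<noteq> None})"
  by (auto simp: cond_push_def pmf_map measure_cond_pmf indicator_def)

lemma cond_push_cong:
  assumes "\<And>y. y \<in> set_pmf p \<Longrightarrow> g y = h y"
  shows "cond_push p g = cond_push p h"
proof -
  have eq: "measure_pmf.prob p {y. g y \<noteq> None \<and> g y = c} = measure_pmf.prob p {y. h y \<noteq> None \<and> h y = c}"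
    "measure_pmf.prob p {y. g y \<noteq> None} = measure_pmf.prob p {y. h y \<noteq> None}" for c
    using assms by (auto intro!: measure_pmf.finite_measure_eq_AE simp: AE_measure_pmf_iff)
  have "set_pmf p \<inter> {y. g y \<noteq> None} = set_pmf p \<inter> {y. h y \<noteq> None}"
    using assms by auto
  moreover have "A \<inter> g -` {c} = {y\<in>A. g y = c}" for A c and g :: "'a \<Rightarrow> 'b option"
    by auto
  ultimately show ?thesis
    using eq by (intro pmf_eqI) (simp add: pmf_cond_push)
qed

text \<open>The first normalising constant cancels against the second. The assumption on
  \<open>h\<close> keeps discarded points discarded, so the survivors of \<open>h \<circ> g\<close>
  are among those of \<open>g\<close>.\<close>

lemma cond_push_cond_push:
  assumes "h None = None"
  shows "cond_push (cond_push p g) h = cond_push p (h \<circ> g)"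
proof (cases "set_pmf p \<inter> {y. h (g y) \<noteq> None} = {}")
  case True
  have "set_pmf (cond_push p g) \<inter> {y. h y \<noteq> None} = {}"
    using True assms by (auto simp: cond_push_def set_cond_pmf split: if_splits)
  with True show ?thesis by (simp add: cond_push_def)
next
  case False
  let ?A = "{y. g y \<noteq> None}" and ?B = "{y. h y \<noteq> None}" and ?C = "{y. h (g y) \<noteq> None}"
  have sub: "?C \<subseteq> ?A" using assms by (intro Collect_mono impI notI) simp
  have A: "set_pmf p \<inter> ?A \<noteq> {}" using False sub by blast
  have B: "set_pmf (map_pmf g (cond_pmf p ?A)) \<inter> ?B \<noteq> {}"
    using False sub A by (auto simp: set_cond_pmf)
  have pos: "measure_pmf.prob p ?A \<noteq> 0" using A by (simp add: measure_pmf_zero_iff)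
  have e: "?A \<inter> g -` ?B = ?C" "?A \<inter> g -` (?B \<inter> h -` {y}) = ?C \<inter> (h \<circ> g) -` {y}" for y
    using sub by auto
  show ?thesis
  proof (rule pmf_eqI)
    fix y
    have "cond_push (cond_push p g) h = map_pmf h (cond_pmf (map_pmf g (cond_pmf p ?A)) ?B)"
      using A B by (simp add: cond_push_def)
    then have "pmf (cond_push (cond_push p g) h) y =
        measure_pmf.prob p (?C \<inter> (h \<circ> g) -` {y}) / measure_pmf.prob p ?C"
      \<comment> \<open>Numerator and denominator both carry the factor 1 /
        \<open>measure_pmf.prob p ?A\<close>, which \<open>pos\<close> allows to cancel.\<close>
      by (simp only: pmf_map measure_cond_pmf [OF B] measure_map_pmf measure_cond_pmf [OF A] e) (simp add: pos [simplified])
    then show "pmf (cond_push (cond_push p g) h) y = pmf (cond_push p (h \<circ> g)) y"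
      using False by (simp add: pmf_cond_push)
  qed
qed

definition filter_step ::
    "('x, 'u, 'o) det_pomdp \<Rightarrow> nat \<Rightarrow> 'u \<Rightarrow> 'o \<Rightarrow> 'x option \<Rightarrow> 'x option" where
  "filter_step D t u z y =
     Option.bind y (\<lambda>x. if obs D (Suc t) (dyn D t x u) u = z then Some (dyn D t x u) else None)"

lemma filter_step_None [simp]: "filter_step D t u z None = None"
  by (simp add: filter_step_def)

lemma filter_step_eq_Some_iff:
  "filter_step D t u z y = Some x' \<longleftrightarrow>
    (\<exists>x. y = Some x \<and> obs D (Suc t) x' u = z \<and> x' = dyn D t x u)"
  by (cases y) (auto simp: filter_step_def)

text \<open>The survivors of the step have mass \<open>obs_prob\<close>. Those moved to
  \<open>x\<close> are the whole preimage of \<open>x\<close> under the dynamics if \<open>x\<close>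
  is compatible with \<open>z\<close>, and none otherwise.\<close>

lemma theta_eq_cond_push:
  fixes D :: "('x::finite, 'u, 'o) det_pomdp"
  shows "theta D t b u z = cond_push b (filter_step D t u z)"
proof (rule pmf_eqI)
  fix y
  let ?h = "filter_step D t u z"
  have "Some ` ((\<lambda>x. obs D (Suc t) (dyn D t x u) u) -` {z}) = {y. ?h y \<noteq> None}"
    by (auto simp: filter_step_def image_iff Option.bind_eq_None_conv split: if_splits)
  then have Q: "obs_prob D t b u z = measure_pmf.prob b {y. ?h y \<noteq> None}"
    by (simp add: obs_prob_def)
  show "pmf (theta D t b u z) y = pmf (cond_push b ?h) y"
  proof (cases "obs_prob D t b u z = 0")
    case True
    then have "set_pmf b \<inter> {y. ?h y \<noteq> None} = {}"
      unfolding Q by (simp add: measure_pmf_zero_iff)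
    with True show ?thesis
      by (simp add: pmf_theta theta_mass_def pmf_cond_push split: option.split)
  next
    case False
    then have ne: "set_pmf b \<inter> {y. ?h y \<noteq> None} \<noteq> {}"
      unfolding Q by (simp add: measure_pmf_zero_iff)
    show ?thesis
    proof (cases y)
      case None
      have "{y. ?h y \<noteq> None} \<inter> ?h -` {None} = {}" by auto
      with None False ne show ?thesis
        by (simp add: pmf_theta sum_theta_mass pmf_cond_push)
    next
      case (Some x)
      have "{y. ?h y \<noteq> None} \<inter> ?h -` {Some x} =
          (if obs D (Suc t) x u = z then Some ` ((\<lambda>x. dyn D t x u) -` {x}) else {})"
        by (auto simp: filter_step_def image_iff bind_eq_Some_conv split: if_splits)
      with Some False ne show ?thesis
        by (simp add: pmf_theta theta_mass_def pmf_cond_push Q)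
    qed
  qed
qed

text \<open>Histories list the control-observation pairs latest first, so the length of the tail is the stage.\<close>

primrec filter_path ::
    "('x, 'u, 'o) det_pomdp \<Rightarrow> ('u \<times> 'o) list \<Rightarrow> 'x option \<Rightarrow> 'x option" where
  "filter_path D [] = id"
| "filter_path D (p # ps) = filter_step D (length ps) (fst p) (snd p) \<circ> filter_path D ps"

text \<open>Controls and initial state determine the trajectory, and a surviving history can only
  contain the observations which that trajectory produces.\<close>

lemma filter_path_inj:
  assumes "map fst ps = map fst qs"
    and "filter_path D ps y \<noteq> None" "filter_path D qs y \<noteq> None"
  shows "ps = qs"
  using assms
proof (induction ps arbitrary: qs)
  case Nil
  then show ?case by simp
next
  case (Cons p ps)
  then obtain q qs' where qs: "qs = q # qs'" by (cases qs) auto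
  \<comment> \<open>As \<open>None\<close> is absorbing, survival of the full histories gives
    survival of their tails.\<close>
  have "ps = qs'"
  proof (rule Cons.IH)
    show "map fst ps = map fst qs'" using Cons.prems(1) by (simp add: qs)
    show "filter_path D ps y \<noteq> None"
      using Cons.prems(2) by (metis comp_apply filter_path.simps(2) filter_step_None)
    show "filter_path D qs' y \<noteq> None"
      using Cons.prems(3) by (metis comp_apply filter_path.simps(2) filter_step_None qs)
  qed
  \<comment> \<open>Equal tails lead to the same state at the same stage. With equal controls the
    successor is the same, and both observations equal its value under \<open>obs\<close>.\<close>
  moreover have "snd p = snd q"
    using Cons.prems \<open>ps = qs'\<close> unfolding qs
    by (auto simp: filter_step_eq_Some_iff)
  ultimately show ?case using Cons.prems(1) qs by (simp add: prod_eq_iff)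
qed

lemma reachable_at_subset:
  fixes D :: "('x::finite, 'u, 'o) det_pomdp"
  assumes "b0 \<in> state_beliefs"
  shows "reachable_at D b0 t \<subseteq> {cond_push b0 (filter_path D ps) | ps. length ps = t}"
proof (induction t)
  case 0
  have sub: "set_pmf b0 \<subseteq> {y. y \<noteq> None}" using assms by (auto simp: state_beliefs_def)
  then have ne: "set_pmf b0 \<inter> {y. y \<noteq> None} \<noteq> {}"
    by (simp add: Int_absorb2 set_pmf_not_empty)
  \<comment> \<open>The empty history acts as \<open>id\<close>, so its push-forward conditions only
    on an event of probability 1.\<close>
  have "cond_pmf b0 {y. y \<noteq> None} = b0"
  proof (rule pmf_eqI)
    have "measure_pmf.prob b0 {y. y \<noteq> None} = 1"
      using sub by (auto simp: measure_pmf.prob_eq_1 AE_measure_pmf_iff)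
    with sub show "pmf (cond_pmf b0 {y. y \<noteq> None}) i = pmf b0 i" for i
      by (subst pmf_cond [OF ne]) (auto simp: set_pmf_iff)
  qed
  with ne show ?case by (simp add: cond_push_def)
next
  case (Suc t)
  show ?case
  proof
    fix b' assume "b' \<in> reachable_at D b0 (Suc t)"
    then obtain b u z where b': "b' = theta D t b u z" and "b \<in> reachable_at D b0 t" by auto
    with Suc obtain ps where "b = cond_push b0 (filter_path D ps)" "length ps = t" by blast
    with b' have "b' = cond_push b0 (filter_path D ((u, z) # ps))" "length ((u, z) # ps) = Suc t"
      by (simp_all add: theta_eq_cond_push cond_push_cond_push)
    then show "b' \<in> {cond_push b0 (filter_path D ps) | ps. length ps = Suc t}" by blast
  qed
qed

text \<open>By induction the earlier terms total at most the last power, so the sum at most doubles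
  it, and 2 \<le> \<open>k\<close>.\<close>

lemma sum_power_le_power_Suc:
  fixes k :: nat
  assumes "k > 1"
  shows "(\<Sum>i\<le>n. k ^ i) \<le> k ^ Suc n"
proof (induction n)
  case 0
  then show ?case using assms by simp
next
  case (Suc n)
  then have "(\<Sum>i\<le>Suc n. k ^ i) \<le> 2 * k ^ Suc n" by simp
  also have "\<dots> \<le> k * k ^ Suc n" using assms by (intro mult_right_mono) auto
  finally show ?case by simp
qed

lemma card_cond_push_le:
  fixes p :: "'a::finite pmf"
  shows "finite (range (cond_push p :: ('a \<Rightarrow> 'b::finite option) \<Rightarrow> _)) \<and>
    card (range (cond_push p :: ('a \<Rightarrow> 'b option) \<Rightarrow> _)) \<le> (1 + CARD('b)) ^ card (set_pmf p)"
proof -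
  \<comment> \<open>Values off the support are irrelevant, so extensional functions on it represent
    all maps.\<close>
  let ?F = "set_pmf p \<rightarrow>\<^sub>E (UNIV :: 'b option set)"
  have fin: "finite ?F" by (simp add: finite_PiE)
  have "cond_push p g = cond_push p (restrict g (set_pmf p))" for g :: "'a \<Rightarrow> 'b option"
    by (rule cond_push_cong) simp
  then have "range (cond_push p :: ('a \<Rightarrow> 'b option) \<Rightarrow> _) \<subseteq> cond_push p ` ?F"
    by (smt (verit, best) image_iff image_subset_iff restrict_PiE_iff UNIV_I)
  moreover have "card (cond_push p ` ?F) \<le> (1 + CARD('b)) ^ card (set_pmf p)"
    using card_image_le [OF fin, of "cond_push p"]
    by (simp add: card_PiE card_UNIV_option)
  ultimately show ?thesis
    using finite_imageI [OF fin, of "cond_push p"]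
    by (intro conjI) (rule finite_subset, assumption+, rule order.trans [OF card_mono])
qed

lemma card_reachable_le_controls:
  fixes D :: "('x::finite, 'u::finite, 'o) det_pomdp"
  assumes "b0 \<in> state_beliefs" and "CARD('u) > 1"
  shows "card (reachable D b0) \<le> 1 + card (set_pmf b0) * CARD('u) ^ card (stages D)"
proof -
  let ?L = "{us :: 'u list. set us \<subseteq> UNIV \<and> length us \<le> horizon D}"
  let ?P = "?L \<times> set_pmf b0"
  \<comment> \<open>The description operator recovers the observations from the controls
    \<open>us\<close> and a surviving state \<open>y\<close>. Pairs without such a history get an
    arbitrary value, which is harmless since \<open>?f\<close> only has to cover the reachable
    beliefs.\<close>
  let ?f = "\<lambda>(us, y). cond_push b0 (filter_path D (THE ps. map fst ps = us \<and> filter_path D ps y \<noteq> None))"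
  have "reachable D b0 \<subseteq> insert (return_pmf None) (?f ` ?P)"
  proof
    fix b assume "b \<in> reachable D b0"
    then obtain ps where b: "b = cond_push b0 (filter_path D ps)" and len: "length ps \<le> horizon D"
      using reachable_at_subset [OF assms(1), of D] by (fastforce simp: reachable_def)
    show "b \<in> insert (return_pmf None) (?f ` ?P)"
    \<comment> \<open>Histories without survivors all yield \<open>return_pmf None\<close>, which
      accounts for the summand 1.\<close>
    proof (cases "set_pmf b0 \<inter> {y. filter_path D ps y \<noteq> None} = {}")
      case True
      then show ?thesis by (simp add: b cond_push_def)
    next
      case False
      then obtain y where y: "y \<in> set_pmf b0" "filter_path D ps y \<noteq> None" by blast
      have "(THE qs. map fst qs = map fst ps \<and> filter_path D qs y \<noteq> None) = ps"
        using y by (intro the_equality) (auto intro: filter_path_inj)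
      then have "b = ?f (map fst ps, y)" by (simp add: b)
      with y len show ?thesis by (intro insertI2 image_eqI [of _ _ "(map fst ps, y)"]) auto
    qed
  qed
  moreover have finL: "finite ?L" by (rule finite_lists_length_le) simp
  ultimately have "card (reachable D b0) \<le> card (insert (return_pmf None) (?f ` ?P))"
    by (intro card_mono) auto
  also have "\<dots> \<le> 1 + card (?f ` ?P)" by (rule card_insert_le_m1) simp_all
  also have "card (?f ` ?P) \<le> card ?P" using finL by (intro card_image_le) auto
  also have "card ?P = card (set_pmf b0) * (\<Sum>i\<le>horizon D. CARD('u) ^ i)"
    by (simp only: card_cartesian_product card_lists_length_le [OF finite] mult.commute)
  \<comment> \<open>The exponent \<open>Suc (horizon D)\<close> is the number of stages, since stage
    0 counts too.\<close>
  also have "\<dots> \<le> card (set_pmf b0) * CARD('u) ^ Suc (horizon D)"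
    by (intro mult_left_mono sum_power_le_power_Suc assms(2)) simp
  finally show ?thesis by (simp add: stages_def)
qed

theorem mainTheorem1:
  fixes D :: "('x::finite, 'u::finite, 'o::finite) det_pomdp"
    and b0 :: "'x option pmf"
  assumes "valid_det_pomdp D"
    and "CARD('u) > 1"
    and "b0 \<in> state_beliefs"
  shows "finite (reachable D b0) \<and>
         card (reachable D b0)
           \<le> min ((1 + CARD('x)) ^ card (set_pmf b0))
                 (1 + card (set_pmf b0) * CARD('u) ^ card (stages D))"
proof -
  have "reachable D b0 \<subseteq> range (cond_push b0)"
    using reachable_at_subset [OF assms(3), of D] by (fastforce simp: reachable_def)
  with card_cond_push_le [of b0, where 'b='x] have "finite (reachable D b0)"
    "card (reachable D b0) \<le> (1 + CARD('x)) ^ card (set_pmf b0)"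
    by (meson finite_subset card_mono le_trans)+
  with card_reachable_le_controls [OF assms(3,2), of D] show ?thesis by simp
qed

end
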